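(* Let $m_4$ denote the asymptotic minimal density of monochromatic $K_4$'s in $2$-colorings of the edges of complete graphs, i.e. $m_4 = \lim_{n\to\infty} \frac{\min_{c_n} k_4(c_n)}{\binom{n}{4}}$, where the minimum is over all $2$-colorings $c_n$ of the edges of $K_n$. Then $$m_4 \geq \frac{1}{34.7858}.$$
   Context: For a positive integer $n$, $K_n$ denotes the complete graph on $n$ vertices. For a $2$-coloring $c_n$ of the edges of $K_n$ (an arbitrary assignment of one of two colors to each edge), $k_4(c_n)$ denotes the number of monochromatic $K_4$'s in $c_n$, that is, the number of $4$-element subsets of the vertex set all six of whose edges receive the same color. The ratio $r_4(n) := \min_{c_n} k_4(c_n) / \binom{n}{4}$ (for $n \ge 4$) is non-decreasing in $n$ and bounded above by $1$, so the limit $m_4 = \lim_{n\to\infty} r_4(n)$ exists. The number $34.7858$ is an exact decimal, i.e. $\frac{1}{34.7858} = \frac{10000}{347858}$. *)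

theory Defs
  imports Complex_Main "HOL-Library.Ramsey"
begin

text \<open>The complete graph \<open>K\<^sub>n\<close> has vertex set \<open>{..<n}\<close> and edge set \<open>[{..<n}]\<^bsup>2\<^esup>\<close>; the two
  colors are the two truth values. Colorings are extensional, hence there are only finitely
  many of them for each \<open>n\<close>.\<close>

definition colorings :: "nat \<Rightarrow> (nat set \<Rightarrow> bool) set"
  where "colorings n = [{..<n}]\<^bsup>2\<^esup> \<rightarrow>\<^sub>E UNIV"

definition mono_K4s :: "nat \<Rightarrow> (nat set \<Rightarrow> bool) \<Rightarrow> nat set set"
  where "mono_K4s n c = {S \<in> [{..<n}]\<^bsup>4\<^esup>. \<exists>b. \<forall>e \<in> [S]\<^bsup>2\<^esup>. c e = b}"

definition k4 :: "nat \<Rightarrow> (nat set \<Rightarrow> bool) \<Rightarrow> nat"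
  where "k4 n c = card (mono_K4s n c)"

text \<open>For \<open>n < 4\<close> the denominator is \<open>0\<close>, so that \<open>r4 n = 0\<close> by the convention for division.\<close>

definition r4 :: "nat \<Rightarrow> real"
  where "r4 n = real (Min (k4 n ` colorings n)) / real (n choose 4)"

definition m4 :: real
  where "m4 = lim r4"

text \<open>The remaining facts show that the minimum and the limit above are proper ones.\<close>

lemma finite_colorings: "finite (colorings n)"
  unfolding colorings_def by (intro finite_PiE finite_imp_finite_nsets) auto

lemma colorings_nonempty: "colorings n \<noteq> {}"
  by (simp add: colorings_def PiE_eq_empty_iff)

lemma finite_mono_K4s: "finite (mono_K4s n c)"
  unfolding mono_K4s_def by (simp add: finite_imp_finite_nsets)

lemma k4_le: "k4 n c \<le> n choose 4"
proof -
  have "k4 n c \<le> card ([{..<n}]\<^bsup>4\<^esup>)"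
    unfolding k4_def mono_K4s_def by (intro card_mono) (auto simp: finite_imp_finite_nsets)
  then show ?thesis by simp
qed

lemma Min_k4_le: "c \<in> colorings n \<Longrightarrow> Min (k4 n ` colorings n) \<le> k4 n c"
  by (intro Min_le) (auto simp: finite_colorings)

lemma r4_nonneg: "0 \<le> r4 n"
  by (simp add: r4_def)

lemma r4_le_1: "r4 n \<le> 1"
proof -
  obtain c where "c \<in> colorings n"
    using colorings_nonempty by blast
  then have "Min (k4 n ` colorings n) \<le> n choose 4"
    using Min_k4_le k4_le le_trans by blast
  then show ?thesis
    by (cases "n < 4") (simp_all add: r4_def divide_le_eq_1)
qed

lemma k4_delete_vertex:
  assumes v: "v < Suc n"
  shows "Min (k4 n ` colorings n) \<le> card {T \<in> mono_K4s (Suc n) c. v \<notin> T}"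
proof -
  define f where "f i = (if i < v then i else Suc i)" for i
  define c' where "c' = restrict (\<lambda>e. c (f ` e)) ([{..<n}]\<^bsup>2\<^esup>)"
  have inj: "inj f"
    by (auto simp: inj_def f_def split: if_splits)
  have cf [simp]: "card (f ` A) = card A" for A
    by (meson card_image inj inj_on_subset subset_UNIV)
  have mono: "f ` S \<in> {T \<in> mono_K4s (Suc n) c. v \<notin> T}" if S: "S \<in> mono_K4s n c'" for S
  proof -
    from S obtain b where S4: "S \<subseteq> {..<n}" "finite S" "card S = 4"
      and b: "\<And>e. e \<in> [S]\<^bsup>2\<^esup> \<Longrightarrow> c' e = b"
      by (auto simp: mono_K4s_def nsets_def)
    have "c e = b" if e: "e \<in> [f ` S]\<^bsup>2\<^esup>" for e
    proof -
      from e obtain x y where xy: "e = {f x, f y}" "x \<in> S" "y \<in> S" "x \<noteq> y"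
        by (elim nsets2_E) auto
      then have "{x, y} \<in> [S]\<^bsup>2\<^esup>" "{x, y} \<in> [{..<n}]\<^bsup>2\<^esup>"
        using S4 by auto
      then show ?thesis
        using b[of "{x, y}"] xy by (simp add: c'_def del: doubleton_in_nsets_2)
    qed
    moreover have "f ` S \<subseteq> {..<Suc n}" "v \<notin> f ` S"
      using S4 by (auto simp: f_def split: if_splits)
    ultimately show ?thesis
      using S4 by (auto simp: mono_K4s_def nsets_def)
  qed
  have "k4 n c' \<le> card {T \<in> mono_K4s (Suc n) c. v \<notin> T}"
    unfolding k4_def
  proof (rule card_inj_on_le[where f = "image f"])
    show "inj_on ((`) f) (mono_K4s n c')"
      using inj by (simp add: inj_on_def inj_image_eq_iff)
  qed (use mono finite_mono_K4s in auto)
  moreover have "c' \<in> colorings n"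
    by (simp add: c'_def colorings_def)
  ultimately show ?thesis
    using Min_k4_le le_trans by blast
qed

lemma sum_k4_delete_vertex:
  "(\<Sum>v<Suc n. card {T \<in> mono_K4s (Suc n) c. v \<notin> T}) = (Suc n - 4) * k4 (Suc n) c"
proof -
  let ?M = "mono_K4s (Suc n) c"
  have "(\<Sum>v<Suc n. card {T \<in> ?M. v \<notin> T}) = (\<Sum>v<Suc n. \<Sum>T\<in>?M. if v \<notin> T then 1 else 0)"
    by (intro sum.cong refl) (simp add: finite_mono_K4s flip: sum.inter_filter)
  also have "\<dots> = (\<Sum>T\<in>?M. \<Sum>v<Suc n. if v \<notin> T then 1 else 0)"
    by (rule sum.swap)
  also have "\<dots> = (\<Sum>T\<in>?M. card ({..<Suc n} - T))"
    by (intro sum.cong refl) (simp add: set_diff_eq del: sum.lessThan_Suc flip: sum.inter_filter)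
  also have "\<dots> = (\<Sum>T\<in>?M. Suc n - 4)"
    by (intro sum.cong refl) (auto simp: mono_K4s_def nsets_def card_Diff_subset)
  finally show ?thesis
    by (simp add: k4_def)
qed

lemma r4_mono: "r4 n \<le> r4 (Suc n)"
proof (cases "n < 4")
  case True
  then have "r4 n = 0"
    by (simp add: r4_def)
  then show ?thesis
    using r4_nonneg by simp
next
  case False
  let ?m = "Min (k4 n ` colorings n)" and ?m' = "Min (k4 (Suc n) ` colorings (Suc n))"
  have "?m' \<in> k4 (Suc n) ` colorings (Suc n)"
    by (intro Min_in) (auto simp: finite_colorings colorings_nonempty)
  then obtain c where c: "k4 (Suc n) c = ?m'"
    by auto
  have "(\<Sum>v<Suc n. ?m) \<le> (\<Sum>v<Suc n. card {T \<in> mono_K4s (Suc n) c. v \<notin> T})"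
    by (intro sum_mono k4_delete_vertex) simp
  then have le: "Suc n * ?m \<le> (Suc n - 4) * ?m'"
    unfolding sum_k4_delete_vertex c by simp
  have "Suc n * (n choose 4) = (Suc n - 4) * (Suc n choose 4)"
    using binomial_absorb_comp[of "Suc n" 4] by simp
  then have eq: "real (Suc n) * real (n choose 4) = real (Suc n - 4) * real (Suc n choose 4)"
    by (metis of_nat_mult)
  have le': "real (Suc n) * real ?m \<le> real (Suc n - 4) * real ?m'"
    using le by (metis of_nat_mono of_nat_mult)
  have pos: "0 < real (Suc n)" "0 < real (Suc n - 4)"
    using False by auto
  have "r4 n = (real (Suc n) * real ?m) / (real (Suc n) * real (n choose 4))"
    using pos by (simp add: r4_def del: of_nat_Suc)
  also have "\<dots> \<le> (real (Suc n - 4) * real ?m') / (real (Suc n) * real (n choose 4))"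
    using le' by (intro divide_right_mono) auto
  also have "\<dots> = r4 (Suc n)"
    unfolding eq r4_def using pos by simp
  finally show ?thesis .
qed

lemma r4_tendsto_m4: "r4 \<longlonglongrightarrow> m4"
proof -
  have "Bseq r4"
    by (rule BseqI'[where K = 1]) (use r4_nonneg r4_le_1 in auto)
  then have "convergent r4"
    by (intro Bseq_mono_convergent) (auto intro: lift_Suc_mono_le r4_mono)
  then show ?thesis
    by (simp add: m4_def convergent_LIMSEQ_iff)
qed

end

theory Submission
  imports Defs "HOL-Library.List_Lexorder" "HOL-Combinatorics.Multiset_Permutations"
    "HOL-Real_Asymp.Real_Asymp"
begin

text \<open>The proof is a flag algebra argument with 4-vertex types on 6-vertex graphs. Regard a coloring as
  a symmetric relation \<open>A\<close> on \<open>V = {..<n}\<close> and sum over all \<open>n\<^sup>6\<close> tuples of vertices, repetitions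
  allowed; the values of \<open>A\<close> on the diagonal are irrelevant, as non-injective 4-tuples make up a vanishing
  fraction. For each of six 4-vertex graphs \<open>T\<close> and each 4-tuple \<open>X\<close> inducing \<open>T\<close>, a positive semidefinite
  quadratic form in the numbers of vertices with a given adjacency to \<open>X\<close> is nonnegative. Subtracting these forms,
  for \<open>A\<close> and for its complement, from the density of monochromatic 4-tuples can only decrease it. What
  remains is an average over 6-tuples of a function of the induced 6-vertex graph, and after
  averaging over the 720 orderings of the tuple this function is at least \<open>1 / 34.7858\<close> on each 6-vertex graph,
  which is checked for the 78 graphs up to isomorphism and complement.

  The forms come from a numerical solution of the semidefinite program that maximizes the
  bound (its optimum is about \<open>1 / 34.7843\<close>). Rounding their Cholesky factors keeps them
  exactly semidefinite.\<close>

subsection \<open>Sums over tuples and over orderings\<close>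

primrec selects :: "'a list \<Rightarrow> ('a \<times> 'a list) list" where
  "selects [] = []"
| "selects (x # xs) = (x, xs) # map (\<lambda>(y, ys). (y, x # ys)) (selects xs)"

primrec tuple_sum :: "'a set \<Rightarrow> nat \<Rightarrow> ('a list \<Rightarrow> int) \<Rightarrow> int" where
  "tuple_sum V 0 f = f []"
| "tuple_sum V (Suc n) f = (\<Sum>x\<in>V. tuple_sum V n (\<lambda>xs. f (x # xs)))"

text \<open>For a list of length \<open>n\<close> this is the sum over its \<open>n!\<close> orderings, counted with multiplicity
  if elements repeat.\<close>

primrec order_sum :: "nat \<Rightarrow> ('a list \<Rightarrow> int) \<Rightarrow> 'a list \<Rightarrow> int" where
  "order_sum 0 f xs = f []"
| "order_sum (Suc n) f xs = (\<Sum>(x, ys)\<leftarrow>selects xs. order_sum n (\<lambda>zs. f (x # zs)) ys)"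

lemma tuple_sum_add: "tuple_sum V n (\<lambda>xs. f xs + g xs) = tuple_sum V n f + tuple_sum V n g"
  by (induction n arbitrary: f g) (simp_all add: sum.distrib)

lemma tuple_sum_cmult: "tuple_sum V n (\<lambda>xs. c * f xs) = c * tuple_sum V n f"
  by (induction n arbitrary: f) (simp_all add: sum_distrib_left)

lemma tuple_sum_const: "tuple_sum V n (\<lambda>_. c) = c * int (card V) ^ n"
  by (induction n) simp_all

lemma tuple_sum_mono:
  assumes "\<And>xs. length xs = n \<Longrightarrow> set xs \<subseteq> V \<Longrightarrow> f xs \<le> g xs"
  shows "tuple_sum V n f \<le> tuple_sum V n g"
  using assms by (induction n arbitrary: f g) (auto intro!: sum_mono)

text \<open>Each of the \<open>Suc n\<close> positions from which an entry can be taken contributes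
  the same total, since moving a coordinate to the front permutes the tuples.\<close>

lemma tuple_sum_selects:
  "tuple_sum V (Suc n) (\<lambda>xs. \<Sum>(x, ys)\<leftarrow>selects xs. f x ys)
     = int (Suc n) * (\<Sum>x\<in>V. tuple_sum V n (f x))"
proof (induction n arbitrary: f)
  case (Suc n)
  have "tuple_sum V (Suc (Suc n)) (\<lambda>xs. \<Sum>(x, ys)\<leftarrow>selects xs. f x ys)
      = (\<Sum>y\<in>V. tuple_sum V (Suc n) (\<lambda>ys. f y ys + (\<Sum>(x, zs)\<leftarrow>selects ys. f x (y # zs))))"
    by (simp add: o_def case_prod_unfold del: tuple_sum.simps(2) add: tuple_sum.simps(2)[of V "Suc n"])
  also have "\<dots> = (\<Sum>y\<in>V. tuple_sum V (Suc n) (f y))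
      + int (Suc n) * (\<Sum>y\<in>V. \<Sum>x\<in>V. tuple_sum V n (\<lambda>zs. f x (y # zs)))"
    by (simp add: tuple_sum_add Suc.IH sum.distrib sum_distrib_left del: tuple_sum.simps(2))
  also have "(\<Sum>y\<in>V. \<Sum>x\<in>V. tuple_sum V n (\<lambda>zs. f x (y # zs))) = (\<Sum>x\<in>V. tuple_sum V (Suc n) (f x))"
    by (subst sum.swap) simp
  finally show ?case
    by (simp add: algebra_simps del: tuple_sum.simps(2))
qed simp

text \<open>Symmetrization: to bound the total of \<open>f\<close> it suffices to bound
  \<open>order_sum n f\<close> on each tuple, even if \<open>f\<close> itself violates the bound on
  some.\<close>

lemma tuple_sum_order_sum: "tuple_sum V n (order_sum n f) = fact n * tuple_sum V n f"
proof (induction n arbitrary: f)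
  case (Suc n)
  have "tuple_sum V (Suc n) (order_sum (Suc n) f)
      = int (Suc n) * (\<Sum>x\<in>V. tuple_sum V n (order_sum n (\<lambda>zs. f (x # zs))))"
    using tuple_sum_selects[of V n "\<lambda>x. order_sum n (\<lambda>zs. f (x # zs))"] by simp
  then show ?case
    by (simp add: Suc.IH flip: sum_distrib_left)
qed simp

text \<open>The remaining lists depend on the order of \<open>xs\<close>, but their multisets do
  not; this makes \<open>order_sum\<close> invariant under reordering.\<close>

lemma mset_selects:
  "image_mset (\<lambda>(x, ys). (x, mset ys)) (mset (selects xs)) = image_mset (\<lambda>x. (x, mset xs - {#x#})) (mset xs)"
proof (induction xs)
  case (Cons a xs)
  have "image_mset (\<lambda>(x, ys). (x, mset ys)) (mset (selects (a # xs)))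
      = add_mset (a, mset xs) (image_mset (\<lambda>(x, M). (x, add_mset a M))
          (image_mset (\<lambda>(x, ys). (x, mset ys)) (mset (selects xs))))"
    by (simp add: image_mset.compositionality o_def case_prod_unfold)
  also have "\<dots> = add_mset (a, mset xs) (image_mset (\<lambda>x. (x, add_mset a (mset xs - {#x#}))) (mset xs))"
    by (simp only: Cons.IH) (simp add: image_mset.compositionality o_def)
  also have "image_mset (\<lambda>x. (x, add_mset a (mset xs - {#x#}))) (mset xs)
      = image_mset (\<lambda>x. (x, mset (a # xs) - {#x#})) (mset xs)"
    by (intro image_mset_cong) (auto simp: multiset_eq_iff)
  finally show ?case
    by simp
qed simp

lemma selects_mset: "(x, ys) \<in> set (selects xs) \<Longrightarrow> mset xs = add_mset x (mset ys)"
  by (induction xs arbitrary: ys) auto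

lemma selects_length: "(x, ys) \<in> set (selects xs) \<Longrightarrow> length xs = Suc (length ys)"
  using selects_mset by (metis size_add_mset size_mset)

lemma selects_map: "selects (map g xs) = map (\<lambda>(x, ys). (g x, map g ys)) (selects xs)"
  by (induction xs) auto

lemma order_sum_perm:
  assumes "mset xs = mset ys" "length xs = n"
  shows "order_sum n f xs = order_sum n f ys"
  using assms
proof (induction n arbitrary: f xs ys)
  case (Suc n)
  \<comment> \<open>Choosing a representative turns each summand into a function of \<open>x\<close>
    and a multiset; by induction all representatives give the same value.\<close>
  define h where "h = (\<lambda>(x, M). order_sum n (\<lambda>zs. f (x # zs)) (SOME zs. mset zs = M))"
  have h: "order_sum (Suc n) f zs = sum_mset (image_mset h (image_mset (\<lambda>x. (x, mset zs - {#x#})) (mset zs)))"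
    if "length zs = Suc n" for zs
  proof -
    have "order_sum n (\<lambda>zs. f (x # zs)) us = h (x, mset us)" if "(x, us) \<in> set (selects zs)" for x us
    proof -
      have "mset (SOME zs. mset zs = mset us) = mset us"
        by (rule someI) (rule refl)
      then show ?thesis
        using Suc.IH[of us "SOME zs. mset zs = mset us" "\<lambda>zs. f (x # zs)"]
          selects_length[OF that] \<open>length zs = Suc n\<close> by (simp add: h_def)
    qed
    then have "order_sum (Suc n) f zs = (\<Sum>(x, us)\<leftarrow>selects zs. h (x, mset us))"
      by (auto intro!: arg_cong[where f = sum_list])
    also have "\<dots> = sum_mset (image_mset h (image_mset (\<lambda>(x, us). (x, mset us)) (mset (selects zs))))"
      by (simp add: image_mset.compositionality o_def case_prod_unfold flip: sum_mset_sum_list)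
    finally show ?thesis
      by (simp only: mset_selects)
  qed
  have "length ys = Suc n"
    using Suc.prems by (metis size_mset)
  then show ?case
    using Suc.prems by (simp only: h)
qed simp

lemma order_sum_map: "order_sum n f (map g xs) = order_sum n (\<lambda>zs. f (map g zs)) xs"
  by (induction n arbitrary: f xs) (simp_all add: selects_map o_def case_prod_unfold)

lemma order_sum_cong:
  assumes "\<And>zs. mset zs = mset xs \<Longrightarrow> f zs = g zs" "length xs = n"
  shows "order_sum n f xs = order_sum n g xs"
  using assms
proof (induction n arbitrary: f g xs)
  case (Suc n)
  have "order_sum n (\<lambda>zs. f (x # zs)) ys = order_sum n (\<lambda>zs. g (x # zs)) ys"
    if "(x, ys) \<in> set (selects xs)" for x ys
    using Suc.prems selects_mset[OF that] selects_length[OF that] by (intro Suc.IH) auto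
  then show ?case
    by (auto intro!: arg_cong[where f = sum_list])
qed simp

lemma order_sum_add: "order_sum n (\<lambda>zs. f zs + g zs) xs = order_sum n f xs + order_sum n g xs"
  by (induction n arbitrary: f g xs) (simp_all add: sum_list_addf case_prod_unfold)

lemma order_sum_zero [simp]: "order_sum n (\<lambda>_. 0) xs = 0"
  by (induction n arbitrary: xs) (simp_all add: case_prod_unfold)

subsection \<open>Weights of flags\<close>

datatype 'a tree = Leaf 'a | Node "'a tree" "'a tree"

primrec look :: "'a tree \<Rightarrow> bool list \<Rightarrow> 'a" where
  "look (Leaf x) bs = x"
| "look (Node l r) bs = (if hd bs then look r (tl bs) else look l (tl bs))"

primrec balanced :: "nat \<Rightarrow> 'a list \<Rightarrow> 'a tree" where
  "balanced 0 xs = Leaf (hd xs)"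
| "balanced (Suc n) xs = Node (balanced n (take (2 ^ n) xs)) (balanced n (drop (2 ^ n) xs))"

primrec dot :: "int list \<Rightarrow> int list \<Rightarrow> int" where
  "dot [] ys = 0"
| "dot (x # xs) ys = (case ys of [] \<Rightarrow> 0 | y # ys \<Rightarrow> x * y + dot xs ys)"

lemma dot_Nil2 [simp]: "dot xs [] = 0"
  by (cases xs) simp_all

lemma dot_commute: "dot xs ys = dot ys xs"
proof (induction xs arbitrary: ys)
  case (Cons x xs)
  then show ?case
    by (cases ys) (simp_all add: mult.commute)
qed simp

text \<open>Padding with zeros gives lists of different lengths a common index range, so that sums
  over \<open>j\<close> and over vertices can be interchanged.\<close>

lemma dot_eq_sum:
  assumes "length xs \<le> n"
  shows "dot xs ys = (\<Sum>j<n. (if j < length xs then xs ! j else 0) * (if j < length ys then ys ! j else 0))"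
  using assms
proof (induction xs arbitrary: ys n)
  case (Cons x xs)
  then obtain m where "n = Suc m" "length xs \<le> m"
    by (cases n) auto
  with Cons.IH[of m] show ?case
    by (cases ys) (simp_all add: sum.lessThan_Suc_shift del: sum.lessThan_Suc cong: if_cong)
qed simp

text \<open>The double sum is the squared norm of the sum of all vectors \<open>f u\<close>.\<close>

lemma sum_dot_nonneg:
  assumes "finite V"
  shows "0 \<le> (\<Sum>u\<in>V. \<Sum>v\<in>V. dot (f u) (f v))"
proof -
  define n where "n = (\<Sum>u\<in>V. length (f u))"
  define g where "g u j = (if j < length (f u) then f u ! j else 0)" for u j
  have "length (f u) \<le> n" if "u \<in> V" for u
    unfolding n_def using assms that by (intro member_le_sum) auto
  then have "(\<Sum>u\<in>V. \<Sum>v\<in>V. dot (f u) (f v)) = (\<Sum>u\<in>V. \<Sum>v\<in>V. \<Sum>j<n. g u j * g v j)"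
    by (intro sum.cong refl) (simp add: dot_eq_sum g_def)
  also have "\<dots> = (\<Sum>u\<in>V. \<Sum>j<n. g u j * (\<Sum>v\<in>V. g v j))"
    by (intro sum.cong refl) (subst sum.swap, simp add: sum_distrib_left)
  also have "\<dots> = (\<Sum>j<n. (\<Sum>v\<in>V. g v j)\<^sup>2)"
    by (subst sum.swap) (simp add: sum_distrib_right power2_eq_square)
  also have "\<dots> \<ge> 0"
    by (intro sum_nonneg) simp
  finally show ?thesis .
qed

text \<open>A graph on a list of vertices is encoded by its lower triangular adjacency matrix; \<open>X\<close> is the
  list of the vertices that come before.\<close>

primrec rows :: "('a \<Rightarrow> 'a \<Rightarrow> bool) \<Rightarrow> 'a list \<Rightarrow> 'a list \<Rightarrow> bool list list" where
  "rows A X [] = []"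
| "rows A X (x # xs) = map (A x) X # rows A (X @ [x]) xs"

lemma length_rows [simp]: "length (rows A X xs) = length xs"
  by (induction xs arbitrary: X) auto

lemma rows_append: "rows A X (xs @ ys) = rows A X xs @ rows A (X @ xs) ys"
  by (induction xs arbitrary: X) auto

lemma rows_map:
  assumes "\<And>i j. i \<in> set (X @ xs) \<Longrightarrow> j \<in> set (X @ xs) \<Longrightarrow> i \<noteq> j \<Longrightarrow> B i j = A (g i) (g j)" "distinct (X @ xs)"
  shows "rows A (map g X) (map g xs) = rows B X xs"
  using assms
proof (induction xs arbitrary: X)
  case (Cons x xs)
  have "rows A (map g (X @ [x])) (map g xs) = rows B (X @ [x]) xs"
    using Cons.prems by (intro Cons.IH) auto
  moreover have "map (A (g x) \<circ> g) X = map (B x) X"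
    using Cons.prems by auto
  ultimately show ?case
    by simp
qed simp

lemma rows_Not: "rows (\<lambda>x y. \<not> A x y) X xs = map (map Not) (rows A X xs)"
  by (induction xs arbitrary: X) auto

text \<open>If the first vertices induce the type \<open>T\<close>, the two vertices after them are weighted by their
  adjacencies to the type. \<^const>\<open>butlast\<close> drops the adjacency between these two.\<close>

primrec flag_weight :: "(bool list \<Rightarrow> bool list \<Rightarrow> int) \<Rightarrow> bool list list \<Rightarrow> bool list list \<Rightarrow> int" where
  "flag_weight w [] G = w (hd G) (butlast (hd (tl G)))"
| "flag_weight w (t # T) G = (if hd G = t then flag_weight w T (tl G) else 0)"

text \<open>Once the type vertices are fixed, the sum over the last two vertices is \<open>d\<close>
  times the number of pairs minus a squared norm. Choices that fail to induce \<open>T\<close>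
  contribute 0 to both sides.\<close>

lemma flag_weight_tuple_sum:
  assumes "finite V"
  shows "tuple_sum V (length T + 2) (\<lambda>zs. flag_weight (\<lambda>a b. d - dot (f a) (f b)) T (rows A X zs))
    \<le> d * int (card V) ^ 2 * tuple_sum V (length T) (\<lambda>zs. of_bool (rows A X zs = T))"
proof (induction T arbitrary: X)
  case Nil
  have "d * int (card V) ^ 2 - (\<Sum>u\<in>V. \<Sum>v\<in>V. dot (f (map (A u) X)) (f (map (A v) X))) \<le> d * int (card V) ^ 2"
    using sum_dot_nonneg[OF assms, of "\<lambda>u. f (map (A u) X)"] by simp
  then show ?case
    by (simp add: numeral_2_eq_2 sum_subtractf algebra_simps)
next
  case (Cons t T)
  have len: "length (t # T) + 2 = Suc (length T + 2)"
    by simp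
  have *: "tuple_sum V (length T + 2) (\<lambda>zs. flag_weight (\<lambda>a b. d - dot (f a) (f b)) (t # T) (rows A X (x # zs)))
    \<le> d * int (card V) ^ 2 * tuple_sum V (length T) (\<lambda>zs. of_bool (rows A X (x # zs) = t # T))" for x
    using Cons.IH[of "X @ [x]"]
    by (cases "map (A x) X = t") (simp_all add: tuple_sum_const del: add_2_eq_Suc')
  show ?case
    unfolding len by (simp only: length_Cons tuple_sum.simps sum_distrib_left) (rule sum_mono, rule *)
qed

text \<open>An ordering is abandoned as soon as it departs from the type, and the two leftover
  vertices appear in one order only.\<close>

primrec flags :: "('a \<Rightarrow> 'a \<Rightarrow> bool) \<Rightarrow> bool list list \<Rightarrow> 'a list \<Rightarrow> 'a list \<Rightarrow> (bool list \<times> bool list) list" where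
  "flags B [] X R = [(map (B (hd R)) X, map (B (hd (tl R))) X)]"
| "flags B (t # T) X R =
    concat (map (\<lambda>(x, S). if map (B x) X = t then flags B T (X @ [x]) S else []) (selects R))"

lemma sum_list_concat_map: "(\<Sum>x\<leftarrow>concat (map g xs). f x) = (\<Sum>y\<leftarrow>xs. \<Sum>x\<leftarrow>g y. f x)"
  by (induction xs) simp_all

text \<open>Both orders of the leftover vertices weigh the same by symmetry of \<open>w\<close>,
  hence the factor 2.\<close>

lemma flag_weight_order_sum:
  assumes "\<And>a b. w a b = w b a" "length R = length T + 2"
  shows "order_sum (length T + 2) (\<lambda>zs. flag_weight w T (rows B X zs)) R = 2 * (\<Sum>(a, b)\<leftarrow>flags B T X R. w a b)"
  using assms(2)
proof (induction T arbitrary: X R)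
  case Nil
  then obtain u v where "R = [u, v]"
    by (auto simp: length_Suc_conv numeral_2_eq_2)
  then show ?case
    using assms(1) by (simp add: numeral_2_eq_2)
next
  case (Cons t T)
  have len: "length (t # T) + 2 = Suc (length T + 2)"
    by simp
  have "order_sum (length T + 2) (\<lambda>zs. flag_weight w (t # T) (rows B X (x # zs))) S
      = 2 * (\<Sum>(a, b)\<leftarrow>(if map (B x) X = t then flags B T (X @ [x]) S else []). w a b)"
    if "(x, S) \<in> set (selects R)" for x S
  proof -
    have "length S = length T + 2"
      using selects_length[OF that] Cons.prems by simp
    with Cons.IH[of S "X @ [x]"] show ?thesis
      by (cases "map (B x) X = t") (simp_all del: add_2_eq_Suc')
  qed
  then have "order_sum (length (t # T) + 2) (\<lambda>zs. flag_weight w (t # T) (rows B X zs)) R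
      = (\<Sum>(x, S)\<leftarrow>selects R. 2 * (\<Sum>(a, b)\<leftarrow>(if map (B x) X = t then flags B T (X @ [x]) S else []). w a b))"
    unfolding len order_sum.simps
    by (intro arg_cong[where f = sum_list] map_cong refl) (clarify, simp only: prod.case)
  also have "\<dots> = 2 * (\<Sum>(a, b)\<leftarrow>flags B (t # T) X R. w a b)"
    by (simp add: sum_list_const_mult sum_list_concat_map case_prod_unfold)
  finally show ?case .
qed

subsection \<open>Canonical orderings\<close>

text \<open>Only the reorderings that agree with \<open>G\<close> so far are followed, and the conditional (like the
  code equation for \<^const>\<open>list_all\<close> below) keeps the simplifier from evaluating the others.\<close>

primrec minimal :: "('a \<Rightarrow> 'a \<Rightarrow> bool) \<Rightarrow> bool list list \<Rightarrow> 'a list \<Rightarrow> 'a list \<Rightarrow> bool" where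
  "minimal B [] X R = True"
| "minimal B (r # G) X R =
    list_all (\<lambda>(x, S). let s = map (B x) X in if r = s then minimal B G (X @ [x]) S else r < s) (selects R)"

lemma minimalI:
  assumes "\<And>zs. mset zs = mset R \<Longrightarrow> G \<le> rows B X zs"
  shows "minimal B G X R"
  using assms
proof (induction G arbitrary: X R)
  case (Cons r G)
  have "if r = map (B x) X then minimal B G (X @ [x]) S else r < map (B x) X" if "(x, S) \<in> set (selects R)" for x S
  proof -
    have *: "r # G \<le> map (B x) X # rows B (X @ [x]) zs" if "mset zs = mset S" for zs
      using Cons.prems[of "x # zs"] selects_mset[OF \<open>(x, S) \<in> set (selects R)\<close>] that by simp
    from *[of S] have "r < map (B x) X \<or> r = map (B x) X"
      by auto
    moreover have "minimal B G (X @ [x]) S" if "r = map (B x) X"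
      using * that by (intro Cons.IH) auto
    ultimately show ?thesis
      by auto
  qed
  then show ?case
    by (auto simp: list_all_iff Let_def)
qed simp

lemma list_all_code [code]:
  "list_all P [] \<longleftrightarrow> True"
  "list_all P (x # xs) \<longleftrightarrow> (if P x then list_all P xs else False)"
  by simp_all

text \<open>On the diagonal this reads past the end of a triangular row and is unspecified;
  \<open>rows_map\<close> shows that this is harmless for distinct vertices.\<close>

definition adj :: "bool list list \<Rightarrow> nat \<Rightarrow> nat \<Rightarrow> bool" where
  "adj G i j = (if j < i then G ! i ! j else G ! j ! i)"

text \<open>Orderly generation: a graph that is least among its reorderings arises by adding a last
  row to such a graph on one vertex fewer, by \<open>least_order_butlast\<close>.\<close>

primrec canonical :: "nat \<Rightarrow> bool list list list" where
  "canonical 0 = [[]]"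
| "canonical (Suc n) = concat (map (\<lambda>G.
    filter (\<lambda>H. minimal (adj H) H [] [0..<Suc n]) (map (\<lambda>r. G @ [r]) (List.n_lists n [False, True])))
      (canonical n))"

lemma nth_rows: "i < length xs \<Longrightarrow> rows A X xs ! i = map (A (xs ! i)) (X @ take i xs)"
  by (induction xs arbitrary: X i) (auto simp: nth_Cons' take_Cons')

lemma adj_rows:
  assumes "symp A" "i < length xs" "j < length xs" "i \<noteq> j"
  shows "adj (rows A [] xs) i j = A (xs ! i) (xs ! j)"
  using assms by (auto simp: adj_def nth_rows dest: sympD)

text \<open>Passes from vertices to positions. Equal entries become different vertices, adjacent
  according to the diagonal of \<open>A\<close>, so tuples with repetitions need no separate
  treatment.\<close>

lemma rows_adj:
  assumes "symp A" "mset zs = mset [0..<length xs]"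
  shows "rows (adj (rows A [] xs)) [] zs = rows A [] (map ((!) xs) zs)"
proof -
  have "distinct zs" "set zs = {0..<length xs}"
    using assms(2) by (metis mset_eq_imp_distinct_iff distinct_upt, metis mset_eq_setD set_upt)
  then show ?thesis
    using rows_map[of "[]" zs "adj (rows A [] xs)" A "(!) xs"] adj_rows[OF assms(1)] by simp
qed

definition least_order :: "('a \<Rightarrow> 'a \<Rightarrow> bool) \<Rightarrow> 'a list \<Rightarrow> bool" where
  "least_order A xs \<longleftrightarrow> (\<forall>ys. mset ys = mset xs \<longrightarrow> rows A [] xs \<le> rows A [] ys)"

lemma least_order_exists:
  obtains ys where "mset ys = mset xs" "least_order A ys"
proof -
  let ?S = "{ys. mset ys = mset xs}"
  have "finite ?S"
    by (rule finite_subset[OF _ finite_lists_length_eq[of "set xs" "length xs"]])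
      (auto dest: mset_eq_setD mset_eq_length)
  then obtain ys where "is_arg_min (rows A []) (\<lambda>ys. ys \<in> ?S) ys"
    using ex_is_arg_min_if_finite[of ?S "rows A []"] by blast
  then have "mset ys = mset xs" "least_order A ys"
    unfolding least_order_def by (auto simp: is_arg_min_linorder)
  then show ?thesis
    by (rule that)
qed

lemma append_le_same_length:
  fixes xs ys :: "'a::linorder list"
  shows "length xs = length ys \<Longrightarrow> xs @ us \<le> ys @ vs \<Longrightarrow> xs \<le> ys"
  by (induction xs ys rule: list_induct2) auto

text \<open>Appending \<open>x\<close> to a better ordering of \<open>xs\<close> would give a better
  ordering of \<open>xs @ [x]\<close>.\<close>

lemma least_order_butlast:
  assumes "least_order A (xs @ [x])"
  shows "least_order A xs"
  unfolding least_order_def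
proof (intro allI impI)
  fix ys assume "mset ys = mset xs"
  then have "rows A [] (xs @ [x]) \<le> rows A [] (ys @ [x])"
    using assms by (simp add: least_order_def del: rows.simps)
  then show "rows A [] xs \<le> rows A [] ys"
    using mset_eq_length[OF \<open>mset ys = mset xs\<close>]
    by (simp only: rows_append) (erule append_le_same_length[rotated], simp)
qed

lemma least_order_minimal:
  assumes "symp A" "\<And>ys. mset ys = mset xs \<Longrightarrow> G \<le> rows A [] ys"
  shows "minimal (adj (rows A [] xs)) G [] [0..<length xs]"
proof (rule minimalI)
  fix zs assume zs: "mset zs = mset [0..<length xs]"
  then have "mset (map ((!) xs) zs) = mset xs"
    by (metis map_nth mset_map)
  then show "G \<le> rows (adj (rows A [] xs)) [] zs"
    using assms(2) rows_adj[OF assms(1) zs] by simp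
qed

lemma rows_least_order_canonical:
  assumes "symp A" "least_order A xs"
  shows "rows A [] xs \<in> set (canonical (length xs))"
  using assms(2)
proof (induction xs rule: rev_induct)
  case (snoc x xs)
  let ?G = "rows A [] (xs @ [x])"
  have "rows A [] xs \<in> set (canonical (length xs))"
    using snoc.IH least_order_butlast[OF snoc.prems] by simp
  moreover have "minimal (adj ?G) ?G [] [0..<length (xs @ [x])]"
    using snoc.prems by (intro least_order_minimal assms(1)) (simp_all add: least_order_def)
  moreover have "map (A x) xs \<in> set (List.n_lists (length xs) [False, True])"
    by (auto simp: set_n_lists)
  ultimately show ?case
    by (auto simp: rows_append)
qed simp

subsection \<open>The certificate\<close>

text \<open>The entry of \<open>vectors\<close> at the adjacency pattern \<open>a\<close> is the row for \<open>a\<close> of a factor \<open>L\<close> of the form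
  \<open>L L\<^sup>T\<close>, without trailing zeros and scaled by \<open>10\<^sup>5\<close>; the order of the rows in the list is that of the
  patterns read as binary numbers. The code equations store the evaluated trees.\<close>

definition vectors0 :: "int list tree" where
  "vectors0 = balanced 4
    [[10718, 10592, 10468, -96829], [-47625, -47065, 50424, -12825], [49304, 48725, 48158, 8137],
     [1204, 1190, 101808], [-47625, 49871, -47652, -12824], [-99413, 2380, 2352, -21759],
     [1204, 101815], [-47390, 49537, 48961, -1942], [49304, -48212, -47651, -12825],
     [1204, -99434, 2352, -21760], [101822], [48973, -47972, 48961, -1943],
     [1204, 1190, -99455, -21759], [-47390, -46832, -46288, -22782],
     [48973, 48397, -48541, -1942], [-10750, -10624, -10500, 97122]]"

schematic_goal vectors0_code [code]: "vectors0 = ?t"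
  by code_simp

definition vectors1 :: "int list tree" where
  "vectors1 = balanced 4
    [[264366], [46761, -114384, -114112, -109630, -6, -12391, 1907, -109],
     [46761, -114384, 114106, 109624, -14, 11734, -4714, 127],
     [-178864, -128402, -30, -28, -94, -3084, -13171, -139],
     [115968, -22795, -91270, 95209, 84636, 10843, 46318, 1118],
     [-18474, 36013, -143271, -57553, 124861], [-18474, 36013, 7952, 198408],
     [-72529, -97319, -43986, 45670, 40350, -6058, -25875, -584],
     [115968, -22795, 91477, -95009, -83975, 11107, 47460],
     [-18474, 36013, -63245, -140852, -124848, 389, 1670, -121], [-18474, 36013, 198568],
     [-72529, -97319, 43872, -45779, -40711, -5930, -25337, -210], [-41885, 230871],
     [18128, -16140, -62973, -60499, 111, 71266],
     [18128, -16140, 63041, 60565, 107, -63983, 31114, 525],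
     [-137968, 141999, -26, -25, -83, -2755, -11771, -141]]"

schematic_goal vectors1_code [code]: "vectors1 = ?t"
  by code_simp

definition vectors2 :: "int list tree" where
  "vectors2 = balanced 4
    [[-162202, -58020, -23396, 104878, 101887, 23902, -11, -1020, -64, 190],
     [-231780, -98547, -2858, 10261, 9835, 31432, 2, 76, 42, -396],
     [-169218, -438, 195759, 32710, 117208, -54089, 89476],
     [-106098, 20252, 19493, -165556, -37226, 93537, 3137, -346, 1092],
     [-169218, -438, -216268, 71505, -15322, -62736, -89469, 722, -141, 27],
     [-106098, 20252, 22056, -41108, -164614, 93003, -3142, -377, -974, -705], [-142806, 389248],
     [-160961, 142967, 17698, -71935, -69496, -100758, -12, -1043, -113, 250],
     [-134791, -268723, -3320, 18990, 18663, -42644, -3, -390, 286, -330],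
     [15093, -147858, -6921, 33839, 33021, -24729, 20, 2126], [199020, 113154, 300853],
     [25635, -72693, 1098, 223760],
     [199020, 113154, -286189, -65995, -64128, -11749, -15, -1280, -278, 991],
     [25635, -72693, -50129, 476, 218075], [430000],
     [329679, 26264, 16170, -88219, -86528, 159900]]"

schematic_goal vectors2_code [code]: "vectors2 = ?t"
  by code_simp

definition vectors3 :: "int list tree" where
  "vectors3 = balanced 4
    [[-152173, 50992, 34540, 26170], [-83459, -65922, -44653, -33832], [-23791, 133958],
     [-64583, -20202, -43864, -33234], [-23791, 49694, 124400], [-64583, -48228, -2489, -33234],
     [-69350, 18228, 12347, -88917], [124563, -425, -288, -28572], [-23791, 49694, 33661, 119759],
     [-64583, -48228, -32668, 6597], [-69350, 18228, -82259, 35946], [124563, -425, -27584, 7454],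
     [-69350, -69628, 47442, 35946], [124563, -25774, 9838, 7454], [194316],
     [31394, 17639, 11948, 9053]]"

schematic_goal vectors3_code [code]: "vectors3 = ?t"
  by code_simp

definition vectors4 :: "int list tree" where
  "vectors4 = balanced 4
    [[48221, 45443, 81439, 67164, 55, 12, 133, -170, 53], [9303, -82271, 25382, 130886], [156941],
     [97472, -97518, -37792, 55980, -600, -673, 1045], [-81574, 14163, 133325],
     [-91569, -86293, 67879, 55980, -169, 1320],
     [11818, -53240, 26798, -102388, 12, 8, 85, -23, 99],
     [-5226, -28480, -6324, -64729, 144, -133, -215, -17, 738], [9303, 156665],
     [-52446, 14953, -95413, 45800, -58, -13, -142, 129, -152],
     [97472, 91856, -57909, -47757, 1398],
     [-40386, -2837, -58239, 6115, -187, 129, -286, -651, -86],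
     [-91569, 103082, 47762, -47757, -551, -698, -955, -186, 40],
     [-28740, -3528, -64749, 6115, 93, -130, 183, 754],
     [-5226, -40147, -5084, -58339, -147, 135, 243, 24, -742],
     [-4398, -4145, -7428, -6126, -7, 4, -42, 8, -43]]"

schematic_goal vectors4_code [code]: "vectors4 = ?t"
  by code_simp

definition vectors5 :: "int list tree" where
  "vectors5 = balanced 4
    [[-13783, -2066, -2205, -6308, -6000, -1005, -1616],
     [40368, 14035, 16263, 39802, 37570, 78601],
     [40368, 22874, 8941, 39936, 37717, -35851, 68770],
     [-11296, -8376, -8048, -23503, -22320, -5633, -9062],
     [-19928, -57150, -37625, -25000, -13365, -7665, -28745],
     [-19162, -157986, 13633, 45953, 43202, 34685, 55799],
     [-19162, 7308, -158405, 64871, 62045, -8124, -13070], [40368, 9848, 13652, 96705],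
     [-19928, 26905, 18239, -37398, -45479, -29583, -31175], [-19162, 7308, 182720],
     [-19162, 182866], [40368, 16811, 22220, 1925, 94102], [285055],
     [-19928, -39879, 28521, -50099, -35924, -694, 12875],
     [-19928, 19299, -57968, -30116, -40664, 3762, -7939],
     [-13783, -2286, -1976, -5903, -5596, -1922, -3092]]"

schematic_goal vectors5_code [code]: "vectors5 = ?t"
  by code_simp

text \<open>The types are the 4-vertex graphs up to isomorphism and complement. The
  weight \<open>10\<^sup>10\<close> of the edgeless type makes the total count monochromatic 4-tuples once the complement is
  added.\<close>

definition certificate :: "(bool list list \<times> int \<times> int list tree) list" where
  "certificate =
   [([[], [False], [False, False], [False, False, False]], 10 ^ 10, vectors0),
    ([[], [True], [False, False], [False, False, False]], 0, vectors1),
    ([[], [True], [True, False], [False, False, False]], 0, vectors2),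
    ([[], [True], [True, True], [False, False, False]], 0, vectors3),
    ([[], [False], [False, True], [True, False, False]], 0, vectors4),
    ([[], [True], [False, True], [True, False, False]], 0, vectors5)]"

primrec flag_sum :: "int \<Rightarrow> int list tree \<Rightarrow> (bool list \<times> bool list) list \<Rightarrow> int" where
  "flag_sum d t [] = 0"
| "flag_sum d t (p # ps) = d - dot (look t (fst p)) (look t (snd p)) + flag_sum d t ps"

definition score :: "(nat \<Rightarrow> nat \<Rightarrow> bool) \<Rightarrow> int" where
  "score B = (\<Sum>(T, d, t)\<leftarrow>certificate. flag_sum d t (flags B T [] [0..<6]))"

text \<open>The sums over orderings have \<open>720\<close> terms, which are to average at least
  \<open>10\<^sup>10 * 10000 / 347858\<close>.\<close>

definition certified :: "bool list list \<Rightarrow> bool" where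
  "certified G \<longleftrightarrow>
    (if minimal (adj G) G [] [0..<6] then
       if minimal (\<lambda>i j. \<not> adj G i j) G [] [0..<6] then
         7200000 * 10 ^ 10 \<le> 347858 * (2 * score (adj G) + 2 * score (\<lambda>i j. \<not> adj G i j))
       else True
     else True)"

text \<open>The 6-vertex graphs are tested as they arise from the 5-vertex ones, without forming
  \<open>canonical 6\<close>.\<close>

definition certified_extensions :: "bool list list \<Rightarrow> bool" where
  "certified_extensions G \<longleftrightarrow> list_all certified (map (\<lambda>r. G @ [r]) (List.n_lists (length G) [False, True]))"

schematic_goal canonical_5: "canonical 5 = ?t"
  by code_simp

definition graphs5 :: "bool list list list" where
  "graphs5 = canonical 5"

declare graphs5_def [unfolded canonical_5, code]

lemma certified_extensions_take: "list_all certified_extensions (take 6 graphs5)"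
  by code_simp

lemma certified_extensions_drop: "list_all certified_extensions (drop 6 graphs5)"
  by code_simp

lemma certified_extensions: "list_all certified_extensions graphs5"
  using certified_extensions_take certified_extensions_drop
  by (subst append_take_drop_id[symmetric, of graphs5 6]) (simp only: list_all_append)

lemma certified_extension:
  assumes "G \<in> set (canonical 5)" "length G = 5" "length r = 5"
  shows "certified (G @ [r])"
proof -
  have "certified_extensions G"
    using certified_extensions assms(1) by (simp add: graphs5_def list_all_iff)
  moreover have "r \<in> set (List.n_lists (length G) [False, True])"
    using assms by (auto simp: set_n_lists)
  ultimately show ?thesis
    by (auto simp: certified_extensions_def list_all_iff)
qed

section \<open>From the checked graphs to arbitrary 6-tuples\<close>

definition weight :: "bool list list \<Rightarrow> int" where
  "weight G = (\<Sum>(T, d, t)\<leftarrow>certificate. flag_weight (\<lambda>a b. d - dot (look t a) (look t b)) T G)"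

text \<open>Adding the complement makes the weight blind to which color counts as adjacency, so one
  graph of each complementary pair suffices.\<close>

definition sym_weight :: "bool list list \<Rightarrow> int" where
  "sym_weight G = weight G + weight (map (map Not) G)"

lemma sym_weight_Not: "sym_weight (map (map Not) G) = sym_weight G"
  by (simp add: sym_weight_def o_def)

lemma certificate_length: "(T, d, t) \<in> set certificate \<Longrightarrow> length T = 4"
  by (auto simp: certificate_def)

lemma flag_sum_eq: "flag_sum d t ps = (\<Sum>(a, b)\<leftarrow>ps. d - dot (look t a) (look t b))"
  by (induction ps) (simp_all add: case_prod_unfold)

lemma order_sum_sum_list: "order_sum n (\<lambda>zs. \<Sum>x\<leftarrow>xs. f x zs) R = (\<Sum>x\<leftarrow>xs. order_sum n (f x) R)"
  by (induction xs) (simp_all add: order_sum_add)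

lemma tuple_sum_sum_list: "tuple_sum V n (\<lambda>zs. \<Sum>x\<leftarrow>xs. f x zs) = (\<Sum>x\<leftarrow>xs. tuple_sum V n (f x))"
  by (induction xs) (simp_all add: tuple_sum_add tuple_sum_const)

lemma order_sum_weight: "order_sum 6 (\<lambda>zs. weight (rows B [] zs)) [0..<6] = 2 * score B"
proof -
  have "order_sum 6 (\<lambda>zs. flag_weight (\<lambda>a b. d - dot (look t a) (look t b)) T (rows B [] zs)) [0..<6]
      = 2 * flag_sum d t (flags B T [] [0..<6])" if "(T, d, t) \<in> set certificate" for T d t
    using flag_weight_order_sum[of "\<lambda>a b. d - dot (look t a) (look t b)" "[0..<6]" T B "[]"]
      certificate_length[OF that] by (simp add: dot_commute flag_sum_eq)
  then have "(\<Sum>(T, d, t)\<leftarrow>certificate.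
        order_sum 6 (\<lambda>zs. flag_weight (\<lambda>a b. d - dot (look t a) (look t b)) T (rows B [] zs)) [0..<6])
      = (\<Sum>(T, d, t)\<leftarrow>certificate. 2 * flag_sum d t (flags B T [] [0..<6]))"
    by (intro arg_cong[where f = sum_list] map_cong) auto
  then show ?thesis
    by (simp add: weight_def score_def order_sum_sum_list case_prod_unfold sum_list_const_mult)
qed

lemma order_sum_adj:
  assumes "symp A" "length xs = n"
  shows "order_sum n (\<lambda>zs. f (rows (adj (rows A [] xs)) [] zs)) [0..<n] = order_sum n (\<lambda>zs. f (rows A [] zs)) xs"
proof -
  have "order_sum n (\<lambda>zs. f (rows (adj (rows A [] xs)) [] zs)) [0..<n]
      = order_sum n (\<lambda>zs. f (rows A [] (map ((!) xs) zs))) [0..<n]"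
    using assms by (intro order_sum_cong) (simp_all add: rows_adj)
  also have "\<dots> = order_sum n (\<lambda>zs. f (rows A [] zs)) (map ((!) xs) [0..<n])"
    by (rule order_sum_map[symmetric])
  also have "map ((!) xs) [0..<n] = xs"
    using assms(2) map_nth by blast
  finally show ?thesis .
qed

text \<open>An ordering that is least among the reorderings of both the graph and its complement
  passes both guards in \<open>certified\<close>, so the tested inequality applies.\<close>

lemma order_sum_sym_weight_least:
  assumes A: "symp A" and xs: "least_order A xs" "length xs = 6"
    and Not: "\<And>ys. mset ys = mset xs \<Longrightarrow> rows A [] xs \<le> rows (\<lambda>x y. \<not> A x y) [] ys"
  shows "7200000 * 10 ^ 10 \<le> 347858 * order_sum 6 (\<lambda>zs. sym_weight (rows A [] zs)) xs"
proof -
  define G where "G = rows A [] xs"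
  obtain ys x where ys: "xs = ys @ [x]" "length ys = 5"
    using xs(2) by (cases xs rule: rev_cases) auto
  have "rows A [] ys \<in> set (canonical 5)"
    using rows_least_order_canonical[OF A least_order_butlast] xs(1) ys by metis
  then have "certified G"
    using certified_extension[of "rows A [] ys" "map (A x) ys"] ys by (simp add: G_def rows_append)
  moreover have "minimal (adj G) G [] [0..<6]"
    using least_order_minimal[OF A, of xs G] xs by (simp add: G_def least_order_def)
  moreover have "minimal (\<lambda>i j. \<not> adj G i j) G [] [0..<6]"
  proof (rule minimalI)
    fix zs assume zs: "mset zs = mset [0..<6]"
    then have "mset (map ((!) xs) zs) = mset xs"
      using xs(2) by (metis map_nth mset_map)
    from Not[OF this] show "G \<le> rows (\<lambda>i j. \<not> adj G i j) [] zs"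
      using rows_adj[OF A, of zs xs] zs xs(2) by (simp add: G_def rows_Not)
  qed
  ultimately have "7200000 * 10 ^ 10 \<le> 347858 * (2 * score (adj G) + 2 * score (\<lambda>i j. \<not> adj G i j))"
    unfolding certified_def by presburger
  also have "2 * score (adj G) + 2 * score (\<lambda>i j. \<not> adj G i j)
      = order_sum 6 (\<lambda>zs. sym_weight (rows (adj G) [] zs)) [0..<6]"
    by (simp only: sym_weight_def order_sum_add rows_Not flip: order_sum_weight)
  also have "\<dots> = order_sum 6 (\<lambda>zs. sym_weight (rows A [] zs)) xs"
    unfolding G_def using order_sum_adj[OF A xs(2)] .
  finally show ?thesis .
qed

text \<open>Of the least orderings for \<open>A\<close> and for its complement, the one with the
  smaller matrix is least overall. Neither reordering nor swapping colors changes the sum.\<close>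

lemma order_sum_sym_weight:
  assumes A: "symp A" and "length xs = 6"
  shows "7200000 * 10 ^ 10 \<le> 347858 * order_sum 6 (\<lambda>zs. sym_weight (rows A [] zs)) xs"
proof -
  let ?A' = "\<lambda>x y. \<not> A x y"
  have A': "symp ?A'"
    using A by (auto simp: symp_def)
  obtain ys where ys: "mset ys = mset xs" "least_order A ys"
    by (rule least_order_exists)
  obtain ys' where ys': "mset ys' = mset xs" "least_order ?A' ys'"
    by (rule least_order_exists)
  have len: "length ys = 6" "length ys' = 6"
    using ys(1) ys'(1) assms(2) by (metis mset_eq_length)+
  show ?thesis
  proof (cases "rows A [] ys \<le> rows ?A' [] ys'")
    case True
    then have "7200000 * 10 ^ 10 \<le> 347858 * order_sum 6 (\<lambda>zs. sym_weight (rows A [] zs)) ys"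
      using ys ys' by (intro order_sum_sym_weight_least A len) (auto simp: least_order_def intro: order_trans)
    then show ?thesis
      using order_sum_perm[OF ys(1) len(1)] by simp
  next
    case False
    then have "rows ?A' [] ys' \<le> rows A [] ys"
      by simp
    then have "7200000 * 10 ^ 10 \<le> 347858 * order_sum 6 (\<lambda>zs. sym_weight (rows ?A' [] zs)) ys'"
      using ys ys' by (intro order_sum_sym_weight_least A' len) (auto simp: least_order_def intro: order_trans)
    then show ?thesis
      using order_sum_perm[OF ys'(1) len(2)] by (simp add: rows_Not sym_weight_Not)
  qed
qed

definition independent_tuples :: "('a \<Rightarrow> 'a \<Rightarrow> bool) \<Rightarrow> 'a set \<Rightarrow> int" where
  "independent_tuples A V = tuple_sum V 4 (\<lambda>zs. of_bool (rows A [] zs = [[], [False], [False, False], [False, False, False]]))"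

lemma tuple_sum_weight:
  assumes "finite V"
  shows "tuple_sum V 6 (\<lambda>zs. weight (rows A [] zs)) \<le> 10 ^ 10 * int (card V) ^ 2 *
    independent_tuples A V"
proof -
  have "tuple_sum V 6 (\<lambda>zs. weight (rows A [] zs)) = (\<Sum>(T, d, t)\<leftarrow>certificate.
      tuple_sum V 6 (\<lambda>zs. flag_weight (\<lambda>a b. d - dot (look t a) (look t b)) T (rows A [] zs)))"
    by (simp add: weight_def tuple_sum_sum_list case_prod_unfold)
  also have "\<dots> \<le> (\<Sum>(T, d, t)\<leftarrow>certificate.
      d * int (card V) ^ 2 * tuple_sum V 4 (\<lambda>zs. of_bool (rows A [] zs = T)))"
  proof (intro sum_list_mono, clarify)
    fix T d t assume "(T, d, t) \<in> set certificate"
    from certificate_length[OF this]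
    show "tuple_sum V 6 (\<lambda>zs. flag_weight (\<lambda>a b. d - dot (look t a) (look t b)) T (rows A [] zs))
       \<le> d * int (card V) ^ 2 * tuple_sum V 4 (\<lambda>zs. of_bool (rows A [] zs = T))"
      using flag_weight_tuple_sum[OF assms, of T d "look t" A "[]"] by simp
  qed
  \<comment> \<open>Only the edgeless type has a nonzero \<open>d\<close>.\<close>
  also have "\<dots> = 10 ^ 10 * int (card V) ^ 2 *
    independent_tuples A V"
    unfolding certificate_def independent_tuples_def by simp
  finally show ?thesis .
qed

subsection \<open>Counting monochromatic cliques\<close>

lemma tuple_sum_eq_sum:
  "tuple_sum V n f = (\<Sum>xs | set xs \<subseteq> V \<and> length xs = n. f xs)"
proof (induction n arbitrary: f)
  case (Suc n)
  let ?L = "\<lambda>n. {xs. set xs \<subseteq> V \<and> length xs = n}"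
  have "?L (Suc n) = (\<lambda>(x, xs). x # xs) ` (V \<times> ?L n)"
    by (auto simp: length_Suc_conv image_iff)
  moreover have "inj_on (\<lambda>(x, xs). x # xs) (V \<times> ?L n)"
    by (auto simp: inj_on_def)
  ultimately show ?case
    by (simp add: Suc.IH sum.reindex sum.cartesian_product o_def case_prod_unfold)
next
  case 0
  have "{xs. set xs \<subseteq> V \<and> xs = []} = {[]}"
    by auto
  then show ?case
    by simp
qed

lemma card_orderings:
  assumes "finite \<S>" "\<And>S. S \<in> \<S> \<Longrightarrow> finite S \<and> card S = k"
  shows "card {xs. distinct xs \<and> set xs \<in> \<S>} = fact k * card \<S>"
proof -
  have "{xs. distinct xs \<and> set xs \<in> \<S>} = (\<Union>S\<in>\<S>. permutations_of_set S)"
    by (auto simp: permutations_of_set_def)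
  also have "card \<dots> = (\<Sum>S\<in>\<S>. card (permutations_of_set S))"
    using assms by (intro card_UN_disjoint) (auto dest: permutations_of_setD)
  also have "\<dots> = fact k * card \<S>"
    using assms by simp
  finally show ?thesis .
qed


section \<open>Bounds on monochromatic 4-tuples and the limit\<close>

lemma monochromatic_tuples_lower_bound:
  assumes "finite V" "V \<noteq> {}" "symp A"
  shows "10000 * int (card V) ^ 4
    \<le> 347858 * (independent_tuples A V + independent_tuples (\<lambda>x y. \<not> A x y) V)"
proof -
  let ?n = "int (card V)" and ?N = "\<lambda>A. independent_tuples A V"
  let ?N' = "?N A + ?N (\<lambda>x y. \<not> A x y)"
  have "7200000 * 10 ^ 10 * ?n ^ 6 = tuple_sum V 6 (\<lambda>_. 7200000 * 10 ^ 10)"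
    by (simp add: tuple_sum_const)
  also have "\<dots> \<le> tuple_sum V 6 (\<lambda>xs. 347858 * order_sum 6 (\<lambda>zs. sym_weight (rows A [] zs)) xs)"
    by (intro tuple_sum_mono order_sum_sym_weight assms(3))
  also have "\<dots> = 347858 * (720 * tuple_sum V 6 (\<lambda>zs. sym_weight (rows A [] zs)))"
    unfolding tuple_sum_cmult tuple_sum_order_sum by (simp add: fact_numeral)
  also have "tuple_sum V 6 (\<lambda>zs. sym_weight (rows A [] zs)) =
      tuple_sum V 6 (\<lambda>zs. weight (rows A [] zs)) + tuple_sum V 6 (\<lambda>zs. weight (rows (\<lambda>x y. \<not> A x y) [] zs))"
    by (simp add: sym_weight_def tuple_sum_add rows_Not)
  also have "\<dots> \<le> 10 ^ 10 * ?n ^ 2 * ?N A + 10 ^ 10 * ?n ^ 2 * ?N (\<lambda>x y. \<not> A x y)"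
    by (intro add_mono tuple_sum_weight assms(1))
  \<comment> \<open>The common factor comes from the 720 orderings, the scale of the weights and the
    two vertices outside the type.\<close>
  finally have "(720 * 10 ^ 10 * ?n ^ 2) * (10000 * ?n ^ 4) \<le> (720 * 10 ^ 10 * ?n ^ 2) * (347858 * ?N')"
    by (simp add: algebra_simps flip: power_add)
  moreover have "0 < 720 * 10 ^ 10 * ?n ^ 2"
    using assms by (simp add: card_gt_0_iff)
  ultimately show ?thesis
    by (rule mult_left_le_imp_le)
qed

text \<open>Here \<open>b\<close> is the color that all pairs avoid, so the clique has the other
  one.\<close>

lemma monochromatic_tuple:
  assumes "set xs \<subseteq> {..<n}" "length xs = 4" "distinct xs"
    and mono: "rows (\<lambda>u v. c {u, v} = b) [] xs = [[], [False], [False, False], [False, False, False]]"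
  shows "set xs \<in> mono_K4s n c"
proof -
  obtain x y z w where xs: "xs = [x, y, z, w]"
    using assms(2) by (auto simp: length_Suc_conv numeral_eq_Suc)
  have "c e = (\<not> b)" if "e \<in> [set xs]\<^bsup>2\<^esup>" for e
  proof -
    from that obtain u v where "e = {u, v}" "u \<in> set xs" "v \<in> set xs" "u \<noteq> v"
      by (elim nsets2_E) auto
    then show ?thesis
      using mono by (auto simp: xs insert_commute)
  qed
  then show ?thesis
    using assms distinct_card[of xs] by (auto simp: mono_K4s_def nsets_def)
qed

text \<open>The tuples with a repetition, \<open>n ^ 4 - 24 * (n choose 4)\<close> in number, count
  at most 1 each. An injective tuple that counts is one of the 24 orderings of a monochromatic
  4-set.\<close>

lemma monochromatic_tuples_upper_bound:
  fixes c :: "nat set \<Rightarrow> bool" and n :: nat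
  defines "A \<equiv> \<lambda>u v. c {u, v}"
  shows "independent_tuples A {..<n} + independent_tuples (\<lambda>x y. \<not> A x y) {..<n}
    \<le> int n ^ 4 - 24 * int (n choose 4) + 24 * int (k4 n c)"
proof -
  let ?T = "[[], [False], [False, False], [False, False, False]]"
  define L where "L = {xs. set xs \<subseteq> {..<n} \<and> length xs = 4}"
  have fin: "finite L"
    unfolding L_def by (rule finite_lists_length_eq) simp
  have "of_bool (rows A [] xs = ?T) + of_bool (rows (\<lambda>x y. \<not> A x y) [] xs = ?T)
      \<le> 1 - of_bool (distinct xs) + (of_bool (distinct xs \<and> set xs \<in> mono_K4s n c) :: int)" if "xs \<in> L" for xs
  proof -
    \<comment> \<open>The second row of \<open>?T\<close> would make the first pair non-adjacent
      both in the graph and in its complement.\<close>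
    have "\<not> (rows A [] xs = ?T \<and> rows (\<lambda>x y. \<not> A x y) [] xs = ?T)"
      by (auto simp: rows_Not)
    moreover have "set xs \<in> mono_K4s n c" if "distinct xs" "rows A [] xs = ?T \<or> rows (\<lambda>x y. \<not> A x y) [] xs = ?T"
      using monochromatic_tuple[of xs n c True] monochromatic_tuple[of xs n c False] that \<open>xs \<in> L\<close>
      by (auto simp: A_def L_def)
    ultimately show ?thesis
      by (auto simp: of_bool_def)
  qed
  then have "(\<Sum>xs\<in>L. of_bool (rows A [] xs = ?T) + of_bool (rows (\<lambda>x y. \<not> A x y) [] xs = ?T))
      \<le> (\<Sum>xs\<in>L. 1 - of_bool (distinct xs) + (of_bool (distinct xs \<and> set xs \<in> mono_K4s n c) :: int))"
    by (rule sum_mono)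
  also have "\<dots> = int (card L) - int (card (L \<inter> {xs. distinct xs}))
      + int (card (L \<inter> {xs. distinct xs \<and> set xs \<in> mono_K4s n c}))"
    using fin by (simp add: sum.distrib sum_subtractf)
  also have "L \<inter> {xs. distinct xs} = {xs. distinct xs \<and> set xs \<in> [{..<n}]\<^bsup>4\<^esup>}"
    using distinct_card by (force simp: L_def nsets_def)
  also have "card \<dots> = 24 * (n choose 4)"
    by (subst card_orderings[where k = 4]) (simp_all add: finite_imp_finite_nsets fact_numeral, auto simp: nsets_def)
  also have "L \<inter> {xs. distinct xs \<and> set xs \<in> mono_K4s n c} = {xs. distinct xs \<and> set xs \<in> mono_K4s n c}"
    using distinct_card by (force simp: L_def nsets_def mono_K4s_def)
  also have "card \<dots> = 24 * k4 n c"
    unfolding k4_def by (subst card_orderings[where k = 4])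
      (auto simp: finite_mono_K4s fact_numeral nsets_def mono_K4s_def)
  also have "card L = n ^ 4"
    unfolding L_def by (simp add: card_lists_length_eq)
  finally show ?thesis
    by (simp add: independent_tuples_def tuple_sum_eq_sum sum.distrib L_def)
qed

text \<open>Combines the two bounds and divides by \<open>24 * (n choose 4)\<close>. The quotient
  compares all 4-tuples with the injective ones and tends to 1.\<close>

lemma r4_lower_bound:
  assumes "4 \<le> n"
  shows "1 - (1 - 1 / 34.7858) * (real n ^ 4 / (24 * real (n choose 4))) \<le> r4 n"
proof -
  obtain c where c: "k4 n c = Min (k4 n ` colorings n)"
    using Min_in[of "k4 n ` colorings n"] finite_colorings colorings_nonempty by fastforce
  have "symp (\<lambda>u v. c {u, v})"
    by (simp add: symp_def insert_commute)
  then have "10000 * int n ^ 4 \<le> 347858 * (independent_tuples (\<lambda>u v. c {u, v}) {..<n}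
      + independent_tuples (\<lambda>u v. \<not> c {u, v}) {..<n})"
    using monochromatic_tuples_lower_bound[of "{..<n}" "\<lambda>u v. c {u, v}"] assms
    by (simp add: lessThan_empty_iff)
  then have "10000 * int n ^ 4 \<le> 347858 * (int n ^ 4 - 24 * int (n choose 4) + 24 * int (k4 n c))"
    by (rule order_trans) (intro mult_left_mono monochromatic_tuples_upper_bound, simp)
  then have "real_of_int (10000 * int n ^ 4)
      \<le> real_of_int (347858 * (int n ^ 4 - 24 * int (n choose 4) + 24 * int (k4 n c)))"
    by (simp only: of_int_le_iff)
  then have "10000 * real n ^ 4 \<le> 347858 * (real n ^ 4 - 24 * real (n choose 4) + 24 * real (k4 n c))"
    by simp
  moreover have pos: "0 < real (n choose 4)"
    using assms by simp
  then have "(1 - (1 - 1 / 34.7858) * (real n ^ 4 / (24 * real (n choose 4)))) * real (n choose 4)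
      = real (n choose 4) - (1 - 1 / 34.7858) * real n ^ 4 / 24"
    by (simp add: left_diff_distrib)
  ultimately have "(1 - (1 - 1 / 34.7858) * (real n ^ 4 / (24 * real (n choose 4)))) * real (n choose 4) \<le> real (k4 n c)"
    by simp
  then show ?thesis
    using pos by (simp only: r4_def pos_le_divide_eq flip: c)
qed

lemma power4_over_binomial_tendsto: "(\<lambda>n. real n ^ 4 / (24 * real (n choose 4))) \<longlonglongrightarrow> 1"
proof -
  have "24 * real (n choose 4) = real n * (real n - 1) * (real n - 2) * (real n - 3)" for n
    by (simp add: binomial_gbinomial gbinomial_prod_rev numeral_eq_Suc)
  then show ?thesis
    by (simp only:) real_asymp
qed

theorem theorem2:
  shows "m4 \<ge> 1 / 34.7858"
proof (rule LIMSEQ_le)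
  show "(\<lambda>n. 1 - (1 - 1 / 34.7858) * (real n ^ 4 / (24 * real (n choose 4)))) \<longlonglongrightarrow> 1 / 34.7858"
    using tendsto_diff[OF tendsto_const tendsto_mult[OF tendsto_const power4_over_binomial_tendsto], of 1 "1 - 1 / 34.7858"]
    by simp
  show "\<exists>N. \<forall>n\<ge>N. 1 - (1 - 1 / 34.7858) * (real n ^ 4 / (24 * real (n choose 4))) \<le> r4 n"
    using r4_lower_bound by blast
qed (rule r4_tendsto_m4)

end
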